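(* Let $i\ge1$ be an integer. (1) If $u_{i-1}u_i<0$, then any point $\Delta^E_{c_1c_2\ldots c_m i(0)}$, where $m\ge 1$, $c_1,\dots,c_m\in\mathbb{Z}_0$ and $D_m=\prod_{j=1}^m u_{c_j}\neq0$, is an extreme point of the function $f$; moreover, it is a maximum point if $D_mu_i>0$ and a minimum point if $D_mu_i<0$. (2) If $u_{i-1}u_i\ge0$, then no point $\Delta^E_{c_1c_2\ldots c_m i(0)}$ (with $m\ge1$ and $c_1,\dots,c_m\in\mathbb{Z}_0$) is an extreme point of the function $f$.
   Context: Let $\mathbb{Z}_0=\{0,1,2,\dots\}$. Every $x\in(0,1]$ has a unique $E$-representation, i.e. there is a unique sequence $(g_n(x))_{n\ge 1}$ of elements of $\mathbb{Z}_0$ with $x=\sum_{n=1}^\infty \frac{1}{(2+g_1)(2+g_1+g_2)\cdots(2+g_1+\dots+g_n)}$, where $g_n=g_n(x)$; this is written $x=\Delta^E_{g_1g_2\ldots g_n\ldots}$. Conversely, every sequence in $\mathbb{Z}_0$ is the $E$-representation of some $x\in(0,1]$. The notation $(0)$ means that the symbol $0$ is repeated forever, so $\Delta^E_{c_1\ldots c_mi(0)}$ is the point with symbols $c_1,\dots,c_m,i,0,0,0,\dots$. Standing assumptions: $(u_n)_{n\ge0}$ is a sequence of real numbers such that $\sum_{n=0}^\infty u_n$ converges with sum $1$, $|u_n|<1$ for all $n\ge 0$, and $r_n:=\sum_{i=n+1}^\infty u_i=1-(u_0+\dots+u_n)$ satisfies $0<r_n<1$ for all $n\ge0$. The function $f$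 is defined on $(0,1]$ by $f(x)=r_{g_1(x)}+\sum_{k=2}^\infty\bigl(r_{g_k(x)}\prod_{i=1}^{k-1}u_{g_i(x)}\bigr)$ (the series converges absolutely), and $f(0):=0$. Extreme (maximum, minimum) points are points of strict local extremum (maximum, minimum) of $f$. *)

theory Defs
  imports Complex_Main "HOL-Library.Omega_Words_Fun"
begin

text \<open>Symbol sequences are indexed from \<open>0\<close>: \<open>g n\<close> stands for the symbol $g_{n+1}$.\<close>

definition E_term :: "(nat \<Rightarrow> nat) \<Rightarrow> nat \<Rightarrow> real" where
  "E_term g n = 1 / (\<Prod>k\<le>n. 2 + (\<Sum>j\<le>k. real (g j)))"

definition E_value :: "(nat \<Rightarrow> nat) \<Rightarrow> real" where
  "E_value g = (\<Sum>n. E_term g n)"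

text \<open>The definite description is meaningful for \<open>x \<in> {0<..1}\<close> only, by existence and
  uniqueness of the \<open>E\<close>-representation there.\<close>

definition E_digits :: "real \<Rightarrow> nat \<Rightarrow> nat" where
  "E_digits x = (THE g. E_term g sums x)"

definition tail_sum :: "(nat \<Rightarrow> real) \<Rightarrow> nat \<Rightarrow> real" where
  "tail_sum u n = (\<Sum>i. u (i + Suc n))"

text \<open>Only the values on \<open>{0..1}\<close> matter. The summand with index \<open>k\<close> is the one that the
  usual notation numbers $k+2$.\<close>

definition E_fun :: "(nat \<Rightarrow> real) \<Rightarrow> real \<Rightarrow> real" where
  "E_fun u x =
    (if 0 < x \<and> x \<le> 1 then
       (let g = E_digits x in
          tail_sum u (g 0) + (\<Sum>k. tail_sum u (g (Suc k)) * (\<Prod>i\<le>k. u (g i))))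
     else 0)"

definition strict_local_max_on :: "real set \<Rightarrow> (real \<Rightarrow> real) \<Rightarrow> real \<Rightarrow> bool" where
  "strict_local_max_on S f x \<longleftrightarrow> x \<in> S \<and> (\<forall>\<^sub>F y in at x within S. f y < f x)"

definition strict_local_min_on :: "real set \<Rightarrow> (real \<Rightarrow> real) \<Rightarrow> real \<Rightarrow> bool" where
  "strict_local_min_on S f x \<longleftrightarrow> x \<in> S \<and> (\<forall>\<^sub>F y in at x within S. f x < f y)"

definition strict_local_extremum_on :: "real set \<Rightarrow> (real \<Rightarrow> real) \<Rightarrow> real \<Rightarrow> bool" where
  "strict_local_extremum_on S f x \<longleftrightarrow> strict_local_max_on S f x \<or> strict_local_min_on S f x"

text \<open>The point with symbols \<open>cs\<close>, then \<open>i\<close>, then \<open>0\<close> forever.\<close>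

definition E_point :: "nat list \<Rightarrow> nat \<Rightarrow> real" where
  "E_point cs i = E_value ((cs @ [i]) \<frown> (\<lambda>_. 0))"

end

theory Submission
  imports Defs
begin

text \<open>Points whose representation starts with a given word form a half-open interval, and a larger
  symbol in one place moves the point to the left. So the right neighbours of the point \<open>p\<close> with
  symbols \<open>cs, i, 0, 0, \<dots>\<close> start with \<open>cs, i - 1\<close>, the left ones with \<open>cs, i\<close>.
  On symbol sequences \<open>f\<close> satisfies \<open>f g = r (g 0) + u (g 0) * f (tail of g)\<close>, a point of the segment
  between \<open>r (g 0)\<close> and \<open>r (g 0) + u (g 0) = r (g 0 - 1)\<close> (where \<open>r (-1) = 1\<close>), hence \<open>0 < f \<le> 1\<close>
  with \<open>f = 1\<close> only at the zero sequence. With \<open>D\<close> the product of the \<open>u c\<close> over \<open>cs\<close>, the increment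
  from \<open>p\<close> is \<open>D * u (i - 1) * f h\<close> to the right and \<open>- D * u i * (1 - f h)\<close> to the left, where \<open>h\<close> is
  the remaining sequence of symbols, so the sign on each side is constant.\<close>

section \<open>Series with a general start: recursion and convergence\<close>

text \<open>The series with an arbitrary start \<open>a\<close> in place of \<open>2\<close>: dropping the first symbol changes the
  start.\<close>

definition engel_term :: "nat \<Rightarrow> (nat \<Rightarrow> nat) \<Rightarrow> nat \<Rightarrow> real" where
  "engel_term a g n = 1 / (\<Prod>k\<le>n. real a + (\<Sum>j\<le>k. real (g j)))"

definition engel :: "nat \<Rightarrow> (nat \<Rightarrow> nat) \<Rightarrow> real" where
  "engel a g = (\<Sum>n. engel_term a g n)"

lemma E_term_eq: "E_term = engel_term 2"
  by (intro ext) (simp add: E_term_def engel_term_def)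

lemma E_value_eq: "E_value = engel 2"
  by (intro ext) (simp add: E_value_def engel_def E_term_eq)

lemma engel_term_0: "engel_term a g 0 = 1 / real (a + g 0)"
  by (simp add: engel_term_def)

lemma engel_term_Suc: "engel_term a g (Suc n) = engel_term (a + g 0) (g \<circ> Suc) n / real (a + g 0)"
  unfolding engel_term_def prod.atMost_Suc_shift sum.atMost_Suc_shift
  by (simp add: add.assoc)

lemma engel_term_pos: "2 \<le> a \<Longrightarrow> 0 < engel_term a g n"
  unfolding engel_term_def by (auto intro!: prod_pos add_pos_nonneg sum_nonneg)

text \<open>Every factor of the denominator is at least \<open>a\<close>, since symbols only
  increase it. The resulting geometric majorant gives convergence, and its sum is the sharp upper
  bound in \<open>engel_le\<close>, attained at the zero sequence.\<close>

lemma engel_term_le: "2 \<le> a \<Longrightarrow> engel_term a g n \<le> (1 / real a) ^ Suc n"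
proof (induction n arbitrary: a g)
  case 0
  then show ?case by (simp add: engel_term_0 frac_le)
next
  case (Suc n)
  have "engel_term (a + g 0) (g \<circ> Suc) n \<le> (1 / real (a + g 0)) ^ Suc n"
    using Suc.prems by (intro Suc.IH) auto
  also have "\<dots> \<le> (1 / real a) ^ Suc n"
    using Suc.prems by (intro power_mono) (auto simp: frac_le)
  finally have "engel_term (a + g 0) (g \<circ> Suc) n * (1 / real (a + g 0)) \<le> (1 / real a) ^ Suc n * (1 / real a)"
    using Suc.prems engel_term_pos[of "a + g 0" "g \<circ> Suc" n]
    by (intro mult_mono) (auto simp: frac_le)
  then show ?case by (simp add: engel_term_Suc mult.commute)
qed

lemma sums_inverse_powers: "2 \<le> a \<Longrightarrow> (\<lambda>n. (1 / real a) ^ Suc n) sums (1 / (real a - 1))"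
  using sums_mult[OF geometric_sums[of "1 / real a"], of "1 / real a"] by (simp add: field_simps)

lemma summable_engel: "2 \<le> a \<Longrightarrow> summable (engel_term a g)"
  using summable_comparison_test'[OF sums_summable[OF sums_inverse_powers], of a 0 "engel_term a g"]
    engel_term_le[of a g] engel_term_pos[of a g] by (simp add: less_imp_le)

lemma engel_unfold:
  assumes "2 \<le> a"
  shows "engel a g = (1 + engel (a + g 0) (g \<circ> Suc)) / real (a + g 0)"
proof -
  have "engel a g = engel_term a g 0 + (\<Sum>n. engel_term a g (Suc n))"
    unfolding engel_def using suminf_split_head[OF summable_engel[OF assms], of g] by simp
  also have "(\<Sum>n. engel_term a g (Suc n)) = engel (a + g 0) (g \<circ> Suc) / real (a + g 0)"
    unfolding engel_term_Suc engel_def using assms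
    by (intro suminf_divide summable_engel) auto
  finally show ?thesis by (simp add: engel_term_0 add_divide_distrib)
qed

lemma engel_pos: "2 \<le> a \<Longrightarrow> 0 < engel a g"
  unfolding engel_def by (intro suminf_pos summable_engel engel_term_pos)

lemma engel_le:
  assumes "2 \<le> a"
  shows "engel a g \<le> 1 / (real a - 1)"
proof -
  have "engel a g \<le> (\<Sum>n. (1 / real a) ^ Suc n)"
    unfolding engel_def using assms
    by (intro suminf_le summable_engel engel_term_le sums_summable[OF sums_inverse_powers])
  then show ?thesis using sums_unique[OF sums_inverse_powers[OF assms]] by simp
qed

lemma engel_zeros: "2 \<le> a \<Longrightarrow> engel a (\<lambda>_. 0) = 1 / (real a - 1)"
  using sums_unique[OF sums_inverse_powers, of a] by (simp add: engel_def engel_term_def power_divide)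

section \<open>First-symbol intervals and uniqueness of the representation\<close>

lemma unit_fraction_step:
  fixes q :: real
  assumes "1 < q"
  shows "(1 + 1 / (q - 1)) / q = 1 / (q - 1)"
proof -
  have "1 + 1 / (q - 1) = q / (q - 1)" using assms by (simp add: field_simps)
  then show ?thesis using assms by simp
qed

text \<open>The tail has its value in the half-open interval from 0 to 1 / (q - 1) with q =
  \<open>a + g 0\<close>, and \<open>engel_unfold\<close> sends a tail value y to (1 + y) /
  q.\<close>

lemma engel_cylinder:
  assumes "2 \<le> a"
  shows "1 / real (a + g 0) < engel a g" "engel a g \<le> 1 / (real (a + g 0) - 1)"
proof -
  have b: "2 \<le> a + g 0" using assms by simp
  show "1 / real (a + g 0) < engel a g"
    using engel_unfold[OF assms, of g] engel_pos[OF b, of "g \<circ> Suc"] assms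
    by (simp add: divide_strict_right_mono)
  have "engel a g \<le> (1 + 1 / (real (a + g 0) - 1)) / real (a + g 0)"
    unfolding engel_unfold[OF assms, of g]
    using engel_le[OF b, of "g \<circ> Suc"] by (intro divide_right_mono add_left_mono) auto
  \<comment> \<open>The right end is the fixed point of the map y to (1 + y) / q.\<close>
  also have "\<dots> = 1 / (real (a + g 0) - 1)"
    using b by (intro unit_fraction_step) simp
  finally show "engel a g \<le> 1 / (real (a + g 0) - 1)" .
qed

text \<open>The intervals of \<open>engel_cylinder\<close> for consecutive first symbols abut, and
  they move to the left as the symbol grows.\<close>

lemma engel_head_less:
  assumes "2 \<le> a" "g 0 < h 0"
  shows "engel a h < engel a g"
proof -
  have "engel a h \<le> 1 / (real (a + h 0) - 1)"
    by (rule engel_cylinder[OF assms(1)])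
  also have "\<dots> \<le> 1 / real (a + g 0)"
    using assms by (intro divide_left_mono) auto
  also have "\<dots> < engel a g" by (rule engel_cylinder[OF assms(1)])
  finally show ?thesis .
qed

text \<open>Equal values force equal first symbols by \<open>engel_head_less\<close>. The recursion
  can then be solved for the value of the tail, so the argument repeats with a new start.\<close>

lemma engel_inj:
  assumes "2 \<le> a" "engel a g = engel a h"
  shows "g = h"
proof
  fix n
  show "g n = h n" using assms
  proof (induction n arbitrary: a g h)
    case 0
    then show ?case using engel_head_less[of a g h] engel_head_less[of a h g]
      by (metis less_irrefl linorder_neqE_nat)
  next
    case (Suc n)
    have 0: "g 0 = h 0"
      using Suc.prems engel_head_less[of a g h] engel_head_less[of a h g]
      by (metis less_irrefl linorder_neqE_nat)
    have "engel (a + g 0) (g \<circ> Suc) = engel (a + g 0) (h \<circ> Suc)"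
      using Suc.prems engel_unfold[of a g] engel_unfold[of a h] 0 by simp
    with Suc.IH[of "a + g 0" "g \<circ> Suc" "h \<circ> Suc"] Suc.prems(1) show ?case by (simp del: o_apply) simp
  qed
qed

section \<open>Existence of the representation by a greedy expansion\<close>

lemma engel_step:
  assumes "2 \<le> a" "0 < x" "x \<le> 1 / (real a - 1)"
  obtains b y where "a \<le> b" "x = (1 + y) / real b" "0 < y" "y \<le> 1 / (real b - 1)"
proof -
  \<comment> \<open>This is the integer with 1 / b < x \<le> 1 / (b - 1), so \<open>b - a\<close> is
    the only possible first symbol. The remainder has to be b * x - 1.\<close>
  define b where "b = nat (\<lfloor>1 / x\<rfloor> + 1)"
  have le: "real a - 1 \<le> 1 / x"
    using assms by (simp add: field_simps)
  have b: "real b = of_int \<lfloor>1 / x\<rfloor> + 1"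
    using assms(2) by (simp add: b_def)
  have bounds: "real b - 1 \<le> 1 / x" "1 / x < real b"
    unfolding b by linarith+
  have "a \<le> b" using le bounds by linarith
  moreover from this have b2: "2 \<le> b" using assms(1) by simp
  moreover have "x = (1 + (real b * x - 1)) / real b" using b2 by simp
  moreover have "0 < real b * x - 1" using bounds(2) assms(2) by (simp add: field_simps)
  moreover have "real b * x - 1 \<le> 1 / (real b - 1)"
  proof -
    have "x \<le> 1 / (real b - 1)" using bounds(1) assms(2) b2 by (simp add: field_simps)
    then have "real b * x - 1 \<le> real b * (1 / (real b - 1)) - 1"
      by (intro diff_right_mono mult_left_mono) auto
    also have "\<dots> = 1 / (real b - 1)" using b2 by (simp add: field_simps)
    finally show ?thesis .
  qed
  ultimately show ?thesis using that by blast
qed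

text \<open>Iterating \<open>engel_step\<close> yields the symbols. The expansion converges to
  \<open>x\<close> because each step back divides the error by a start that is at least 2.\<close>

lemma engel_surj:
  assumes "2 \<le> a" "0 < x" "x \<le> 1 / (real a - 1)"
  obtains g where "engel a g = x"
proof -
  \<comment> \<open>A state consists of the current start and the remainder still to be
    expanded.\<close>
  define valid where "valid s \<longleftrightarrow> 2 \<le> fst s \<and> 0 < snd s \<and> snd s \<le> 1 / (real (fst s) - 1)"
    for s :: "nat \<times> real"
  have "\<exists>s. \<forall>n. (valid (s n) \<and> (n = 0 \<longrightarrow> s n = (a, x))) \<and>
      (fst (s n) \<le> fst (s (Suc n)) \<and> snd (s n) = (1 + snd (s (Suc n))) / real (fst (s (Suc n))))"
  proof (rule dependent_nat_choice)
    show "\<exists>s. valid s \<and> (0 = (0::nat) \<longrightarrow> s = (a, x))"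
      using assms by (auto simp: valid_def)
  next
    fix s and n :: nat
    assume "valid s \<and> (n = 0 \<longrightarrow> s = (a, x))"
    then have s: "2 \<le> fst s" "0 < snd s" "snd s \<le> 1 / (real (fst s) - 1)"
      by (auto simp: valid_def)
    obtain b y where "fst s \<le> b" "snd s = (1 + y) / real b" "0 < y" "y \<le> 1 / (real b - 1)"
      using engel_step[OF s] .
    then show "\<exists>t. (valid t \<and> (Suc n = 0 \<longrightarrow> t = (a, x))) \<and>
        (fst s \<le> fst t \<and> snd s = (1 + snd t) / real (fst t))"
      using s by (intro exI[of _ "(b, y)"]) (auto simp: valid_def)
  qed
  then obtain s where valid: "\<And>n. valid (s n)" and s0: "s 0 = (a, x)"
    and mono: "\<And>n. fst (s n) \<le> fst (s (Suc n))"
    and step: "\<And>n. snd (s n) = (1 + snd (s (Suc n))) / real (fst (s (Suc n)))"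
    by metis
  \<comment> \<open>Symbols are the increments of the start. The starts never decrease, so the
    truncated subtraction is exact.\<close>
  define g where "g n = fst (s (Suc n)) - fst (s n)" for n
  \<comment> \<open>The error at stage \<open>n\<close>: the remainder against the series of the
    symbols from \<open>n\<close> on. Both numbers lie between 0 and 1, so the error is at most 1,
    and halving gives \<open>e 0 \<le> (1 / 2) ^ n\<close>.\<close>
  define e where "e n = \<bar>snd (s n) - engel (fst (s n)) (\<lambda>k. g (n + k))\<bar>" for n
  have e_step: "e n \<le> e (Suc n) / 2" for n
  proof -
    have ge2: "2 \<le> fst (s k)" for k using valid by (simp add: valid_def)
    have "engel (fst (s n)) (\<lambda>k. g (n + k)) =
        (1 + engel (fst (s (Suc n))) (\<lambda>k. g (Suc n + k))) / real (fst (s (Suc n)))"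
      using engel_unfold[OF ge2, of n "\<lambda>k. g (n + k)"] mono[of n] by (simp add: g_def o_def)
    then have "e n = e (Suc n) / real (fst (s (Suc n)))"
      unfolding e_def by (subst step) (simp flip: diff_divide_distrib add: abs_divide)
    also have "\<dots> \<le> e (Suc n) / 2"
      using ge2[of "Suc n"] by (intro divide_left_mono) (simp_all add: e_def)
    finally show ?thesis .
  qed
  have e_le: "e n \<le> 1" for n
  proof -
    have v: "2 \<le> fst (s n)" "0 < snd (s n)" "snd (s n) \<le> 1 / (real (fst (s n)) - 1)"
      using valid[of n] by (auto simp: valid_def)
    have "1 / (real (fst (s n)) - 1) \<le> 1" using v(1) by simp
    then show ?thesis
      using v engel_pos[OF v(1), of "\<lambda>k. g (n + k)"] engel_le[OF v(1), of "\<lambda>k. g (n + k)"]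
      unfolding e_def by linarith
  qed
  have "e 0 \<le> (1 / 2) ^ n * e n" for n
  proof (induction n)
    case (Suc n)
    have "(1 / 2) ^ n * e n \<le> (1 / 2) ^ n * (e (Suc n) / 2)"
      by (intro mult_left_mono e_step) auto
    also have "\<dots> = (1 / 2) ^ Suc n * e (Suc n)" by simp
    finally show ?case using Suc by (rule order_trans[rotated])
  qed simp
  then have "e 0 \<le> (1 / 2) ^ n" for n
    using e_le[of n] by (smt (verit) mult_left_le zero_le_power divide_nonneg_nonneg)
  then have "e 0 \<le> 0"
    by (intro LIMSEQ_le_const[OF LIMSEQ_realpow_zero[of "1 / 2"]]) auto
  then have "engel a g = x" by (simp add: e_def s0)
  with that show ?thesis .
qed

section \<open>Prefixes of symbol sequences and recovery of the digits\<close>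

lemma build_comp_Suc: "(c ## g) \<circ> Suc = g"
  by (simp add: fun_eq_iff)

text \<open>Each symbol of the prefix contributes an increasing affine map y to (1 + y) / q and
  raises the start. Questions about points with prefix \<open>cs\<close> thus reduce to an empty
  prefix with start \<open>a + sum_list cs\<close>.\<close>

lemma engel_conc:
  assumes "2 \<le> a"
  obtains \<alpha> \<beta> where "0 \<le> \<alpha>" "0 < \<beta>" "\<And>g. engel a (cs \<frown> g) = \<alpha> + \<beta> * engel (a + sum_list cs) g"
  using assms
proof (induction cs arbitrary: a thesis)
  case Nil
  show ?case by (rule Nil(1)[of 0 1]) auto
next
  case (Cons c cs)
  obtain \<alpha> \<beta> where *: "0 \<le> \<alpha>" "0 < \<beta>"
    "\<And>g. engel (a + c) (cs \<frown> g) = \<alpha> + \<beta> * engel (a + c + sum_list cs) g"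
    using Cons.IH[of "a + c"] Cons.prems(2) by auto
  show ?case
  proof (rule Cons.prems(1)[of "(1 + \<alpha>) / real (a + c)" "\<beta> / real (a + c)"])
    show "0 \<le> (1 + \<alpha>) / real (a + c)" "0 < \<beta> / real (a + c)"
      using * Cons.prems(2) by auto
    show "engel a ((c # cs) \<frown> g) = (1 + \<alpha>) / real (a + c)
        + \<beta> / real (a + c) * engel (a + sum_list (c # cs)) g" for g
      using engel_unfold[OF Cons.prems(2), of "c ## (cs \<frown> g)"]
      by (simp add: build_comp_Suc * add.assoc add_divide_distrib)
  qed
qed

lemma E_digits_engel: "E_digits (engel 2 g) = g"
  unfolding E_digits_def E_term_eq
proof (rule the_equality)
  show "engel_term 2 g sums engel 2 g"
    unfolding engel_def by (intro summable_sums summable_engel) auto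
  show "h = g" if "engel_term 2 h sums engel 2 g" for h
    using that by (intro engel_inj[of 2]) (auto simp: engel_def[of _ h] sums_iff)
qed

section \<open>The function on symbol sequences: recursion and bounds\<close>

locale E_weights =
  fixes u :: "nat \<Rightarrow> real"
  assumes sums_1: "u sums 1"
    and abs_u: "\<And>n. \<bar>u n\<bar> < 1"
    and tail_sum_bounds: "\<And>n. 0 < tail_sum u n \<and> tail_sum u n < 1"
begin

text \<open>The empty product at \<open>k = 0\<close> absorbs the leading summand that
  \<open>E_fun\<close> writes separately.\<close>

definition F_term :: "(nat \<Rightarrow> nat) \<Rightarrow> nat \<Rightarrow> real" where
  "F_term g k = tail_sum u (g k) * (\<Prod>i<k. u (g i))"

definition F :: "(nat \<Rightarrow> nat) \<Rightarrow> real" where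
  "F g = (\<Sum>k. F_term g k)"

lemma tail_sum_eq: "tail_sum u n = 1 - (\<Sum>i<Suc n. u i)"
  using suminf_minus_initial_segment[OF sums_summable[OF sums_1], of "Suc n"]
  by (simp add: tail_sum_def sums_unique[OF sums_1, symmetric])

lemma tail_sum_Suc: "tail_sum u n = tail_sum u (Suc n) + u (Suc n)"
  by (simp add: tail_sum_eq)

lemma tail_sum_0: "tail_sum u 0 = 1 - u 0"
  by (simp add: tail_sum_eq)

lemma u_0_pos: "0 < u 0"
  using tail_sum_bounds[of 0] by (simp add: tail_sum_0)

text \<open>The sum is \<open>tail_sum u (n - 1)\<close> for positive \<open>n\<close> and equals 1
  for \<open>n = 0\<close>.\<close>

lemma tail_sum_plus_bounds: "0 < tail_sum u n + u n" "tail_sum u n + u n \<le> 1"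
  by (cases n; use tail_sum_bounds[of "n - 1"] in \<open>simp add: tail_sum_0 flip: tail_sum_Suc\<close>)+

text \<open>The terms tend to 0, so all but finitely many are below 1/2 in absolute value, and a
  maximum handles the rest. A bound uniform in the index makes the products in \<open>F_term\<close>
  decay geometrically.\<close>

lemma u_uniform_bound: obtains q where "0 \<le> q" "q < 1" "\<And>n. \<bar>u n\<bar> \<le> q"
proof -
  have "u \<longlonglongrightarrow> 0"
    by (rule summable_LIMSEQ_zero[OF sums_summable[OF sums_1]])
  then obtain N where N: "\<And>n. n \<ge> N \<Longrightarrow> \<bar>u n\<bar> < 1 / 2"
    using LIMSEQ_D[of u 0 "1 / 2"] by auto
  define q where "q = Max (insert (1 / 2) ((\<lambda>n. \<bar>u n\<bar>) ` {..<N}))"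
  have "1 / 2 \<le> q" unfolding q_def by (intro Max_ge) auto
  moreover have "q < 1" unfolding q_def by (subst Max_less_iff) (auto simp: abs_u)
  moreover have "\<bar>u n\<bar> \<le> q" for n
  proof (cases "n < N")
    case True
    then show ?thesis unfolding q_def by (intro Max_ge) auto
  next
    case False
    then show ?thesis using N[of n] \<open>1 / 2 \<le> q\<close> by simp
  qed
  ultimately show ?thesis using that[of q] by simp
qed

lemma summable_F: "summable (F_term g)"
proof -
  obtain q where q: "0 \<le> q" "q < 1" "\<And>n. \<bar>u n\<bar> \<le> q" using u_uniform_bound by blast
  show ?thesis
  proof (rule summable_comparison_test')
    show "summable (\<lambda>k. q ^ k)" using q by (simp add: summable_geometric)
    fix k :: nat
    have "\<bar>\<Prod>i<k. u (g i)\<bar> \<le> (\<Prod>i<k. q)"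
      unfolding abs_prod by (intro prod_mono) (simp add: q)
    then have "\<bar>tail_sum u (g k)\<bar> * \<bar>\<Prod>i<k. u (g i)\<bar> \<le> 1 * q ^ k"
      using tail_sum_bounds[of "g k"] by (intro mult_mono) auto
    then show "norm (F_term g k) \<le> q ^ k" by (simp add: F_term_def abs_mult)
  qed
qed

lemma F_term_Suc: "F_term g (Suc k) = u (g 0) * F_term (g \<circ> Suc) k"
  unfolding F_term_def prod.lessThan_Suc_shift by simp

lemma F_unfold: "F g = tail_sum u (g 0) + u (g 0) * F (g \<circ> Suc)"
proof -
  have "F g = F_term g 0 + (\<Sum>k. F_term g (Suc k))"
    unfolding F_def using suminf_split_head[OF summable_F[of g]] by simp
  then show ?thesis
    by (simp add: F_term_Suc suminf_mult summable_F F_def) (simp add: F_term_def)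
qed

lemma convex_bounds:
  fixes r s t :: real
  assumes "0 \<le> t" "t \<le> 1"
  shows "min r (r + s) \<le> r + s * t" "r + s * t \<le> max r (r + s)"
proof -
  have "0 \<le> s * t \<and> s * t \<le> s \<or> s \<le> s * t \<and> s * t \<le> 0"
    using assms by (cases "0 \<le> s") (auto simp: mult_left_le mult_le_0_iff mult_le_cancel_left1 mult_le_cancel_left2)
  then show "min r (r + s) \<le> r + s * t" "r + s * t \<le> max r (r + s)" by auto
qed

text \<open>The recursion for \<open>F\<close> has no base case, so the bounds are proved for
  partial sums. One more term makes the partial sum a point between \<open>tail_sum u (g 0)\<close>
  and \<open>tail_sum u (g 0) + u (g 0)\<close>, both in [0,1].\<close>

lemma F_partial_bounds: "0 \<le> (\<Sum>k<n. F_term g k) \<and> (\<Sum>k<n. F_term g k) \<le> 1"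
proof (induction n arbitrary: g)
  case (Suc n)
  have "(\<Sum>k<Suc n. F_term g k) = tail_sum u (g 0) + u (g 0) * (\<Sum>k<n. F_term (g \<circ> Suc) k)"
    by (subst sum.lessThan_Suc_shift) (simp add: F_term_Suc flip: sum_distrib_left, simp add: F_term_def)
  then show ?case
    using Suc[of "g \<circ> Suc"] convex_bounds[of "\<Sum>k<n. F_term (g \<circ> Suc) k" "tail_sum u (g 0)" "u (g 0)"]
      tail_sum_bounds[of "g 0"] tail_sum_plus_bounds[of "g 0"] by linarith
qed simp

lemma F_nonneg: "0 \<le> F g" and F_le_1: "F g \<le> 1"
  using F_partial_bounds[of g] summable_LIMSEQ[OF summable_F[of g]]
  unfolding F_def by (auto intro: LIMSEQ_le_const LIMSEQ_le_const2)

text \<open>Both ends of the segment containing \<open>F g\<close> are positive.\<close>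

lemma F_pos: "0 < F g"
  using convex_bounds(1)[OF F_nonneg F_le_1, of "tail_sum u (g 0)" "u (g 0)" "g \<circ> Suc"]
    tail_sum_bounds[of "g 0"] tail_sum_plus_bounds(1)[of "g 0"]
  unfolding F_unfold[of g] by linarith

lemma F_zeros: "F (\<lambda>_. 0) = 1"
proof -
  have "F (\<lambda>_. 0) * (1 - u 0) = 1 - u 0"
    using F_unfold[of "\<lambda>_. 0"] by (simp add: o_def tail_sum_0 algebra_simps)
  then show ?thesis using abs_u[of 0] by auto
qed

text \<open>For first symbol \<open>Suc k\<close> the ends of the segment are
  \<open>tail_sum u (Suc k)\<close> and \<open>tail_sum u k\<close>, both below 1.\<close>

lemma F_less_1_head:
  assumes "g 0 \<noteq> 0"
  shows "F g < 1"
proof -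
  obtain k where "g 0 = Suc k" using assms not0_implies_Suc by blast
  then show ?thesis
    using convex_bounds(2)[OF F_nonneg F_le_1, of "tail_sum u (g 0)" "u (g 0)" "g \<circ> Suc"]
      tail_sum_bounds[of k] tail_sum_bounds[of "Suc k"] tail_sum_Suc[of k]
    unfolding F_unfold[of g] by (auto simp: max_def split: if_splits)
qed

text \<open>After a leading 0 the recursion reads 1 - F g = u 0 * (1 - F (g \<circ> Suc)) with
  \<open>u 0\<close> positive, so strictness passes from the tail to the whole sequence.\<close>

lemma F_less_1:
  assumes "g n \<noteq> 0"
  shows "F g < 1"
  using assms
proof (induction n arbitrary: g)
  case (Suc n)
  show ?case
  proof (cases "g 0 = 0")
    case True
    have "u 0 * F (g \<circ> Suc) < u 0 * 1"
      using Suc u_0_pos by (intro mult_strict_left_mono) auto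
    then show ?thesis using F_unfold[of g] True by (simp add: tail_sum_0)
  qed (rule F_less_1_head)
qed (rule F_less_1_head)

lemma F_conc:
  obtains A where "\<And>g. F (cs \<frown> g) = A + (\<Prod>c\<leftarrow>cs. u c) * F g"
proof (induction cs arbitrary: thesis)
  case Nil
  show ?case by (rule Nil[of 0]) (simp)
next
  case (Cons c cs)
  obtain A where "\<And>g. F (cs \<frown> g) = A + (\<Prod>c\<leftarrow>cs. u c) * F g"
    using Cons.IH by blast
  then show ?case
    by (intro Cons.prems[of "tail_sum u c + u c * A"])
      (subst F_unfold, simp add: build_comp_Suc algebra_simps)
qed

section \<open>Transfer to the unit interval and signs on both sides of a point\<close>

lemma E_fun_engel: "E_fun u (engel 2 g) = F g"
proof -
  have "0 < engel 2 g" "engel 2 g \<le> 1"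
    using engel_pos[of 2 g] engel_le[of 2 g] by auto
  moreover have "F g = F_term g 0 + (\<Sum>k. F_term g (Suc k))"
    unfolding F_def using suminf_split_head[OF summable_F[of g]] by simp
  ultimately show ?thesis
    by (simp add: E_fun_def E_digits_engel F_term_def lessThan_Suc_atMost)
qed

text \<open>Stating exact signs, with 0 for a side on which the function is constant, lets one lemma
  serve both to prove and to refute extremality.\<close>

lemma E_fun_near_E_point:
  fixes cs :: "nat list"
  assumes "1 \<le> i"
  defines "D \<equiv> (\<Prod>c\<leftarrow>cs. u c)" and "p \<equiv> E_point cs i"
  obtains l r where "0 \<le> l" "l < p" "p < r" "r \<le> 1"
    "\<And>x. p < x \<Longrightarrow> x < r \<Longrightarrow> sgn (E_fun u x - E_fun u p) = sgn (D * u (i - 1))"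
    "\<And>x. l < x \<Longrightarrow> x < p \<Longrightarrow> sgn (E_fun u x - E_fun u p) = - sgn (D * u i)"
proof -
  define b where "b = 2 + sum_list cs"
  have b: "2 \<le> b" by (simp add: b_def)
  obtain \<alpha> \<beta> where \<alpha>: "0 \<le> \<alpha>" and \<beta>: "0 < \<beta>"
    and conc: "\<And>g. engel 2 (cs \<frown> g) = \<alpha> + \<beta> * engel b g"
    using engel_conc[of 2 cs] unfolding b_def by auto
  obtain A where A: "\<And>g. F (cs \<frown> g) = A + D * F g" using F_conc[of cs] unfolding D_def by blast
  have zeros: "engel b (k ## (\<lambda>_. 0)) = 1 / (real (b + k) - 1)" for k
  proof -
    have "engel b (k ## (\<lambda>_. 0)) = (1 + 1 / (real (b + k) - 1)) / real (b + k)"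
      using engel_unfold[OF b, of "k ## (\<lambda>_. 0)"] b engel_zeros[of "b + k"]
      by (simp add: build_comp_Suc)
    also have "\<dots> = 1 / (real (b + k) - 1)"
      using b by (intro unit_fraction_step) simp
    finally show ?thesis .
  qed
  have p_eq: "p = engel 2 (cs \<frown> (i ## (\<lambda>_. 0)))"
    by (simp add: p_def E_point_def E_value_eq)
  then have p: "p = \<alpha> + \<beta> * (1 / (real (b + i) - 1))"
    by (simp only: conc zeros)
  have f_p: "E_fun u p = A + D * (tail_sum u i + u i)"
    using F_unfold[of "i ## (\<lambda>_. 0)"] unfolding p_eq E_fun_engel A
    by (simp add: build_comp_Suc F_zeros)
  have tail_i: "tail_sum u (i - 1) = tail_sum u i + u i"
    using tail_sum_Suc[of "i - 1"] assms(1) by simp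
  \<comment> \<open>The points strictly above \<open>l\<close> and up to \<open>p\<close> are those
    starting with \<open>cs, i\<close>. The points strictly above \<open>p\<close> and up to
    \<open>r\<close> are those starting with \<open>cs, i - 1\<close>, and \<open>r\<close> itself
    continues with zeros.\<close>
  define l where "l = \<alpha> + \<beta> * (1 / real (b + i))"
  define r where "r = \<alpha> + \<beta> * (1 / (real (b + (i - 1)) - 1))"
  have r_le: "r \<le> 1"
    using engel_le[of 2 "cs \<frown> ((i - 1) ## (\<lambda>_. 0))"] by (simp only: r_def conc zeros) simp
  \<comment> \<open>Undoing the affine map of the prefix puts \<open>x\<close> into the range of
    \<open>engel b\<close>, so \<open>x\<close> has a representation with prefix
    \<open>cs\<close>.\<close>
  have digits: "\<exists>g. x = engel 2 (cs \<frown> g) \<and> engel b g = (x - \<alpha>) / \<beta>" if "l < x" "x < r" for x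
  proof -
    have "0 < \<beta> * (1 / real (b + i))" using \<beta> b by simp
    then have "0 < (x - \<alpha>) / \<beta>" using that(1) \<beta> by (simp add: l_def)
    moreover have "(x - \<alpha>) / \<beta> \<le> 1 / (real b - 1)"
    proof -
      have "(x - \<alpha>) / \<beta> \<le> 1 / (real (b + (i - 1)) - 1)"
        using that(2) \<beta> by (simp add: r_def field_simps)
      also have "\<dots> \<le> 1 / (real b - 1)" using b by (intro divide_left_mono) auto
      finally show ?thesis .
    qed
    ultimately obtain g where "engel b g = (x - \<alpha>) / \<beta>" using engel_surj[OF b] by blast
    then show ?thesis using \<beta> by (intro exI[of _ g]) (simp add: conc)
  qed
  show ?thesis
  proof (rule that[of l r])
    show "0 \<le> l" using \<alpha> \<beta> by (simp add: l_def)
    show lp: "l < p"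
      unfolding p l_def using \<beta> b by (intro add_strict_left_mono mult_strict_left_mono divide_strict_left_mono) auto
    show pr: "p < r"
      unfolding p r_def using \<beta> b assms(1) by (intro add_strict_left_mono mult_strict_left_mono divide_strict_left_mono) auto
    show "r \<le> 1" by (rule r_le)
    fix x
    {
      assume x: "p < x" "x < r"
      obtain g where g: "x = engel 2 (cs \<frown> g)" "engel b g = (x - \<alpha>) / \<beta>"
        using digits[of x] x lp by auto
      have lo: "1 / (real (b + i) - 1) < engel b g" and up: "engel b g < 1 / (real (b + (i - 1)) - 1)"
        using x \<beta> unfolding g(2) p r_def by (auto simp: pos_less_divide_eq pos_divide_less_eq mult.commute)
      \<comment> \<open>A larger symbol would put \<open>x\<close> at or left of \<open>p\<close>, a
        smaller one beyond \<open>r\<close>.\<close>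
      have "\<not> i - 1 < g 0"
      proof
        assume "i - 1 < g 0"
        then have "1 / (real (b + g 0) - 1) \<le> 1 / (real (b + i) - 1)"
          using b by (intro divide_left_mono) auto
        then show False using lo engel_cylinder(2)[OF b, of g] by linarith
      qed
      moreover have "\<not> g 0 < i - 1"
      proof
        assume "g 0 < i - 1"
        then have "1 / (real (b + (i - 1)) - 1) \<le> 1 / real (b + g 0)"
          using b by (intro divide_left_mono) auto
        then show False using up engel_cylinder(1)[OF b, of g] by linarith
      qed
      ultimately have g0: "g 0 = i - 1" by simp
      \<comment> \<open>The value at \<open>p\<close> is \<open>A + D * tail_sum u (i - 1)\<close>
        by \<open>tail_i\<close>, so the \<open>tail_sum\<close> terms cancel.\<close>
      have "E_fun u x - E_fun u p = D * u (i - 1) * F (g \<circ> Suc)"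
        unfolding g(1) E_fun_engel A f_p F_unfold[of g] g0 tail_i by (simp add: algebra_simps)
      then show "sgn (E_fun u x - E_fun u p) = sgn (D * u (i - 1))"
        using F_pos[of "g \<circ> Suc"] by (simp add: sgn_mult)
    next
      assume x: "l < x" "x < p"
      obtain g where g: "x = engel 2 (cs \<frown> g)" "engel b g = (x - \<alpha>) / \<beta>"
        using digits[of x] x pr by auto
      have lo: "1 / real (b + i) < engel b g" and up: "engel b g < 1 / (real (b + i) - 1)"
        using x \<beta> unfolding g(2) p l_def by (auto simp: pos_less_divide_eq pos_divide_less_eq mult.commute)
      have "\<not> i < g 0"
      proof
        assume "i < g 0"
        then have "1 / (real (b + g 0) - 1) \<le> 1 / real (b + i)"
          using b by (intro divide_left_mono) auto
        then show False using lo engel_cylinder(2)[OF b, of g] by linarith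
      qed
      moreover have "\<not> g 0 < i"
      proof
        assume "g 0 < i"
        then have "1 / (real (b + i) - 1) \<le> 1 / real (b + g 0)"
          using b by (intro divide_left_mono) auto
        then show False using up engel_cylinder(1)[OF b, of g] by linarith
      qed
      ultimately have g0: "g 0 = i" by simp
      \<comment> \<open>Otherwise \<open>x\<close> would be \<open>p\<close>. A nonzero later symbol
        makes \<open>1 - F (g \<circ> Suc)\<close> strictly positive.\<close>
      have "\<exists>n. (g \<circ> Suc) n \<noteq> 0"
      proof (rule ccontr)
        assume "\<nexists>n. (g \<circ> Suc) n \<noteq> 0"
        then have "g n = (i ## (\<lambda>_. 0)) n" for n
          using g0 by (cases n) auto
        then have "g = i ## (\<lambda>_. 0)" ..
        then show False using x(2) g(1) p_eq by simp
      qed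
      then have less: "0 < 1 - F (g \<circ> Suc)" using F_less_1 by auto
      have "E_fun u x - E_fun u p = - (D * u i * (1 - F (g \<circ> Suc)))"
        unfolding g(1) E_fun_engel A f_p F_unfold[of g] g0 by (simp add: algebra_simps)
      then show "sgn (E_fun u x - E_fun u p) = - sgn (D * u i)"
        using less by (simp add: sgn_mult sgn_minus)
    }
  qed
qed

text \<open>A strict extremum means that the increment has the same nonzero sign on both sides, -1
  for a maximum and 1 for a minimum.\<close>

lemma strict_local_extremum_E_point_iff:
  fixes cs :: "nat list"
  assumes "1 \<le> i"
  defines "D \<equiv> (\<Prod>c\<leftarrow>cs. u c)"
  shows "strict_local_max_on {0..1} (E_fun u) (E_point cs i) \<longleftrightarrow> D * u (i - 1) < 0 \<and> 0 < D * u i"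
    and "strict_local_min_on {0..1} (E_fun u) (E_point cs i) \<longleftrightarrow> 0 < D * u (i - 1) \<and> D * u i < 0"
proof -
  define p where "p = E_point cs i"
  obtain l r where lr: "0 \<le> l" "l < p" "p < r" "r \<le> 1"
    and right: "\<And>x. p < x \<Longrightarrow> x < r \<Longrightarrow> sgn (E_fun u x - E_fun u p) = sgn (D * u (i - 1))"
    and left: "\<And>x. l < x \<Longrightarrow> x < p \<Longrightarrow> sgn (E_fun u x - E_fun u p) = - sgn (D * u i)"
    using E_fun_near_E_point[OF assms(1), of cs] unfolding D_def p_def by metis
  \<comment> \<open>Since 0 < p < 1, neighbourhoods relative to the unit interval are ordinary
    two-sided ones.\<close>
  have within: "at p within {0..1} = at p"
    using lr by (intro at_within_Icc_at) auto
  have ev_right: "\<forall>\<^sub>F x in at_right p. sgn (E_fun u x - E_fun u p) = sgn (D * u (i - 1))"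
    using lr right unfolding eventually_at_right_field by blast
  have ev_left: "\<forall>\<^sub>F x in at_left p. sgn (E_fun u x - E_fun u p) = - sgn (D * u i)"
    using lr left unfolding eventually_at_left_field by blast
  \<comment> \<open>Near \<open>p\<close> the sign is constant on each side. One-sided punctured
    neighbourhoods are nonempty, so a constant condition holds eventually only if it is
    true.\<close>
  have sgn_iff: "(\<forall>\<^sub>F x in at p. sgn (E_fun u x - E_fun u p) = \<sigma>) \<longleftrightarrow>
      sgn (D * u (i - 1)) = \<sigma> \<and> sgn (D * u i) = - \<sigma>" for \<sigma>
  proof -
    have "(\<forall>\<^sub>F x in at_right p. sgn (E_fun u x - E_fun u p) = \<sigma>) \<longleftrightarrow>
        (\<forall>\<^sub>F x in at_right p. sgn (D * u (i - 1)) = \<sigma>)"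
      by (rule eventually_cong[OF ev_right]) simp
    moreover have "(\<forall>\<^sub>F x in at_left p. sgn (E_fun u x - E_fun u p) = \<sigma>) \<longleftrightarrow>
        (\<forall>\<^sub>F x in at_left p. - sgn (D * u i) = \<sigma>)"
      by (rule eventually_cong[OF ev_left]) simp
    ultimately show ?thesis
      unfolding eventually_at_split by (auto simp: eventually_const_iff)
  qed
  have p: "p \<in> {0..1}" using lr by simp
  show "strict_local_max_on {0..1} (E_fun u) (E_point cs i) \<longleftrightarrow> D * u (i - 1) < 0 \<and> 0 < D * u i"
    using sgn_iff[of "- 1"] p
    unfolding strict_local_max_on_def p_def[symmetric] within minus_minus sgn_1_pos sgn_1_neg by simp
  show "strict_local_min_on {0..1} (E_fun u) (E_point cs i) \<longleftrightarrow> 0 < D * u (i - 1) \<and> D * u i < 0"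
    using sgn_iff[of 1] p
    unfolding strict_local_min_on_def p_def[symmetric] within sgn_1_pos sgn_1_neg by simp
qed

end

theorem theorem6:
  fixes u :: "nat \<Rightarrow> real" and i :: nat
  assumes "u sums 1"
    and "\<And>n. \<bar>u n\<bar> < 1"
    and "\<And>n. 0 < tail_sum u n \<and> tail_sum u n < 1"
    and "i \<ge> 1"
  shows "(u (i - 1) * u i < 0 \<longrightarrow>
           (\<forall>cs. cs \<noteq> [] \<and> (\<Prod>c\<leftarrow>cs. u c) \<noteq> 0 \<longrightarrow>
              strict_local_extremum_on {0..1} (E_fun u) (E_point cs i) \<and>
              ((\<Prod>c\<leftarrow>cs. u c) * u i > 0 \<longrightarrow>
                 strict_local_max_on {0..1} (E_fun u) (E_point cs i)) \<and>
              ((\<Prod>c\<leftarrow>cs. u c) * u i < 0 \<longrightarrow>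
                 strict_local_min_on {0..1} (E_fun u) (E_point cs i)))) \<and>
         (u (i - 1) * u i \<ge> 0 \<longrightarrow>
           (\<forall>cs. cs \<noteq> [] \<longrightarrow>
              \<not> strict_local_extremum_on {0..1} (E_fun u) (E_point cs i)))"
proof -
  interpret E_weights u using assms(1-3) by unfold_locales auto
  define D where "D cs = (\<Prod>c\<leftarrow>cs. u c)" for cs
  \<comment> \<open>An extremum occurs exactly when the two one-sided factors have opposite signs,
    that is, when their product is negative. The square shows that the prefix affects this only by
    whether \<open>D cs\<close> vanishes.\<close>
  have "D cs * u (i - 1) * (D cs * u i) = (D cs)\<^sup>2 * (u (i - 1) * u i)" for cs
    by (simp add: power2_eq_square)
  then have "(D cs)\<^sup>2 * (u (i - 1) * u i) < 0 \<longleftrightarrow>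
      0 < D cs * u (i - 1) \<and> D cs * u i < 0 \<or> D cs * u (i - 1) < 0 \<and> 0 < D cs * u i" for cs
    by (metis mult_less_0_iff)
  moreover have "(D cs)\<^sup>2 * (u (i - 1) * u i) < 0 \<longleftrightarrow> D cs \<noteq> 0 \<and> u (i - 1) * u i < 0" for cs
    using zero_less_power2[of "D cs"] by (simp only: mult_less_0_iff[of "(D cs)\<^sup>2"]) auto
  ultimately have "0 < D cs * u (i - 1) \<and> D cs * u i < 0 \<or> D cs * u (i - 1) < 0 \<and> 0 < D cs * u i
      \<longleftrightarrow> D cs \<noteq> 0 \<and> u (i - 1) * u i < 0" for cs
    by blast
  then show ?thesis
    unfolding strict_local_extremum_on_def strict_local_extremum_E_point_iff[OF assms(4)] D_def[symmetric]
    by (smt (verit))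
qed

end
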